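(* Let $n \geq 3$ and let $p(z)=\sum_{j=0}^{n} a_j z^j$ be a real polynomial with positive coefficients $a_0,\dots,a_n>0$. Define $$\mu=\left(\max_{0\leq j\leq n-3}\frac{a_j}{a_{j+3}}\right)^{1/3}\quad\text{and}\quad R=\mu^2+\frac{a_{n-1}}{a_n}\mu+\frac{a_{n-2}}{a_n},$$ and let $c_1$ and $c_2$ be the zeros of the quadratic $z^2+\frac{a_{n-1}}{a_n}z+\frac{a_{n-2}}{a_n}$, labelled so that $$c_1=\tfrac12\left(-\tfrac{a_{n-1}}{a_n}+\left(\tfrac{a_{n-1}^2}{a_n^2}-4\tfrac{a_{n-2}}{a_n}\right)^{1/2}\right),\qquad c_2=\tfrac12\left(-\tfrac{a_{n-1}}{a_n}-\left(\tfrac{a_{n-1}^2}{a_n^2}-4\tfrac{a_{n-2}}{a_n}\right)^{1/2}\right).$$ Then all the zeros of $p$ are included in the union of disks $$\{z\in\mathbb{C}:|z-c_1|\leq R^{1/2}\}\ \cup\ \{z\in\mathbb{C}:|z-c_2|\leq R^{1/2}\}.$$ If the two disks are disjoint, then $c_1,c_2$ are real with $c_2<c_1<0$, the disk centered at $c_2$ contains one zero of $p$, and the one centered at $c_1$ contains the remaining $n-1$ zeros of $p$.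
   Context: Zeros are complex zeros, counted with multiplicity. The square root of a nonnegative real number is the nonnegative one (when the argument is negative, either choice of complex square root may be used). *)

theory Defs
  imports "HOL-Analysis.Analysis" "HOL-Computational_Algebra.Polynomial"
begin

text \<open>Number of zeros in \<open>S\<close>, counted with multiplicity; meaningful only for nonzero \<open>p\<close>.\<close>

definition num_zeros_in :: "complex poly \<Rightarrow> complex set \<Rightarrow> nat" where
  "num_zeros_in p S = (\<Sum>z \<in> {z \<in> S. poly p z = 0}. order z p)"

end

theory Submission
  imports Defs "HOL-Complex_Analysis.Residue_Theorem"
    "HOL-Computational_Algebra.Fundamental_Theorem_Algebra"
begin

text \<open>
  Write \<open>B = a\<^bsub>n-1\<^esub> / a\<^bsub>n\<^esub>\<close>, \<open>C = a\<^bsub>n-2\<^esub> / a\<^bsub>n\<^esub>\<close> and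
  \<open>q(z) = z\<^sup>2 + B z + C = (z - c\<^sub>1) (z - c\<^sub>2)\<close>, so that \<open>R = q(\<mu>)\<close>. The proof is an
  Enestroem--Kakeya argument with the multiplier \<open>z\<^sup>3 - \<mu>\<^sup>3\<close> in place of \<open>z - \<mu>\<close>: one has
  \<open>(z\<^sup>3 - \<mu>\<^sup>3) P(z) = a\<^bsub>n\<^esub> z\<^bsup>n+1\<^esup> q(z) - h(z)\<close> with \<open>deg h \<le> n\<close> (\<open>cubic_mult_sum\<close>), and \<open>\<mu>\<close> is
  chosen exactly so that all coefficients of \<open>h\<close> are nonnegative. Putting \<open>z = \<mu>\<close> gives
  \<open>h(\<mu>) = a\<^bsub>n\<^esub> \<mu>\<^bsup>n+1\<^esup> R\<close>. For \<open>r \<ge> \<mu>\<close>, nonnegativity and \<open>deg h \<le> n\<close> make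
  \<open>h(r) / r\<^bsup>n+1\<^esup>\<close> nonincreasing, whence \<open>|h(z)| \<le> a\<^bsub>n\<^esub> |z|\<^bsup>n+1\<^esup> R\<close> if \<open>|z| \<ge> \<mu>\<close>. On the other hand
  \<open>|q(z)| \<le> q(\<mu>) = R\<close> if \<open>|z| \<le> \<mu>\<close>. Hence wherever \<open>|q(z)| > R\<close>, the leading part
  \<open>a\<^bsub>n\<^esub> z\<^bsup>n+1\<^esup> q(z)\<close> strictly dominates \<open>h\<close> (\<open>norm_lower_terms_less\<close>) and \<open>P(z) \<noteq> 0\<close>. Outside
  both disks \<open>|z - c\<^sub>1| |z - c\<^sub>2| > R\<close>, which gives the inclusion.

  If the disks are disjoint, then \<open>|c\<^sub>1 - c\<^sub>2| > 2 R\<^bsup>1/2\<^esup>\<close>, that is, \<open>|d| > 4 R\<close>. As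
  \<open>- d \<le> 4 C < 4 R\<close>, this forces \<open>d > 4 R > 0\<close>, so the centres are real, and they are negative
  because \<open>C > 0\<close>. On the circle around \<open>c\<^sub>2\<close> the domination holds, so by Rouche's theorem
  (\<open>Rouche_poly_cball\<close>) the product \<open>(z\<^sup>3 - \<mu>\<^sup>3) P(z)\<close> has as many zeros in the disk around \<open>c\<^sub>2\<close>
  as \<open>z\<^bsup>n+1\<^esup> q(z)\<close>. From \<open>B\<^sup>2 = d + 4 C > 4 \<mu>\<^sup>2\<close> it follows that \<open>B > 2 \<mu>\<close>; that disk lies to the left of
  the midpoint \<open>- B / 2\<close> of the centres, hence in \<open>|z| > \<mu>\<close>. So it contains neither \<open>0\<close> nor a
  zero of \<open>z\<^sup>3 - \<mu>\<^sup>3\<close>, the count is \<open>1\<close>, and it is a count for \<open>P\<close> itself. By the fundamental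
  theorem of algebra the other \<open>n - 1\<close> zeros are in the other disk.
\<close>

section \<open>Counting zeros\<close>

lemma zorder_poly_eq_order:
  fixes p :: "complex poly"
  assumes "p \<noteq> 0"
  shows "zorder (poly p) z = int (order z p)"
proof -
  obtain q where q: "p = [:- z, 1:] ^ order z p * q" "\<not> [:- z, 1:] dvd q"
    using order_decomp[OF assms] by blast
  show ?thesis
  proof (rule zorder_eqI[of UNIV _ "poly q"])
    show "poly q z \<noteq> 0"
      using q(2) by (simp add: poly_eq_0_iff_dvd)
    show "poly p w = poly q w * (w - z) powi int (order z p)" for w
      by (subst q(1)) (simp add: poly_power mult.commute)
  qed (auto intro: holomorphic_intros)
qed

text \<open>
  This translates the weighted sums of Rouche's theorem, which run over all zeros in a domain,
  into the number of zeros in a disk: the winding number of the circle is the indicator function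
  of the disk.
\<close>

lemma sum_winding_number_circlepath_eq_num_zeros_in:
  fixes p :: "complex poly"
  assumes "p \<noteq> 0" "r > 0" "\<And>z. z \<in> sphere c r \<Longrightarrow> poly p z \<noteq> 0"
  shows "(\<Sum>z \<in> {z \<in> UNIV. poly p z = 0}. winding_number (circlepath c r) z * zorder (poly p) z)
    = of_nat (num_zeros_in p (cball c r))"
proof -
  have fin: "finite {z. poly p z = 0}"
    using assms(1) by (rule poly_roots_finite)
  have wn: "winding_number (circlepath c r) z = (if z \<in> cball c r then 1 else 0)"
    if "poly p z = 0" for z
  proof (cases "z \<in> cball c r")
    case True
    with assms(3)[of z] that have "norm (z - c) < r"
      by (force simp: dist_norm norm_minus_commute)
    then show ?thesis
      using True by (simp add: winding_number_circlepath)
  next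
    case False
    have "winding_number (circlepath c r) z = 0"
      by (rule winding_number_zero_outside[of _ "cball c r"])
        (use False assms(2) in \<open>auto simp: sphere_def\<close>)
    then show ?thesis
      using False by simp
  qed
  have "(\<Sum>z \<in> {z. poly p z = 0}. winding_number (circlepath c r) z * zorder (poly p) z)
    = (\<Sum>z \<in> {z. poly p z = 0}. if z \<in> cball c r then of_nat (order z p) else 0)"
    by (rule sum.cong) (simp_all add: wn zorder_poly_eq_order[OF assms(1)])
  also have "\<dots> = (\<Sum>z \<in> {z. poly p z = 0} \<inter> cball c r. of_nat (order z p))"
    using fin by (rule sum.inter_restrict[symmetric])
  also have "{z. poly p z = 0} \<inter> cball c r = {z \<in> cball c r. poly p z = 0}"
    by auto
  finally show ?thesis
    by (simp add: num_zeros_in_def)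
qed

lemma Rouche_poly_cball:
  fixes f g :: "complex poly"
  assumes "r > 0" "\<And>z. z \<in> sphere c r \<Longrightarrow> cmod (poly g z) < cmod (poly f z)"
  shows "num_zeros_in (f + g) (cball c r) = num_zeros_in f (cball c r)"
proof -
  have f: "poly f z \<noteq> 0" and fg: "poly (f + g) z \<noteq> 0" if "z \<in> sphere c r" for z
    using assms(2)[OF that] by (auto simp: add_eq_0_iff)
  have "c + of_real r \<in> sphere c r"
    using assms(1) by (simp add: dist_norm)
  then have nz: "f \<noteq> 0" "f + g \<noteq> 0"
    using f fg by fastforce+
  have "(\<Sum>z\<in>{z \<in> UNIV. poly f z + poly g z = 0}. winding_number (circlepath c r) z *
        zorder (\<lambda>z. poly f z + poly g z) z)
    = (\<Sum>z\<in>{z \<in> UNIV. poly f z = 0}. winding_number (circlepath c r) z * zorder (poly f) z)"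
    by (rule Rouche_theorem)
      (use assms poly_roots_finite[OF nz(1)] poly_roots_finite[OF nz(2)]
        in \<open>auto intro!: holomorphic_intros\<close>)
  moreover have "poly f z + poly g z = poly (f + g) z" for z
    by simp
  ultimately have "(\<Sum>z\<in>{z \<in> UNIV. poly (f + g) z = 0}. winding_number (circlepath c r) z *
        zorder (poly (f + g)) z)
    = (\<Sum>z\<in>{z \<in> UNIV. poly f z = 0}. winding_number (circlepath c r) z * zorder (poly f) z)"
    by (simp only:)
  also have "\<dots> = of_nat (num_zeros_in f (cball c r))"
    by (rule sum_winding_number_circlepath_eq_num_zeros_in[OF nz(1) assms(1) f])
  also have "(\<Sum>z\<in>{z \<in> UNIV. poly (f + g) z = 0}. winding_number (circlepath c r) z *
        zorder (poly (f + g)) z) = of_nat (num_zeros_in (f + g) (cball c r))"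
    by (rule sum_winding_number_circlepath_eq_num_zeros_in[OF nz(2) assms(1) fg])
  finally show ?thesis
    by (simp only: of_nat_eq_iff)
qed

lemma num_zeros_in_mult_nonvanishing:
  assumes "p \<noteq> 0" "q \<noteq> 0" "\<And>z. z \<in> S \<Longrightarrow> poly q z \<noteq> 0"
  shows "num_zeros_in (q * p) S = num_zeros_in p S"
  unfolding num_zeros_in_def
proof (rule sum.cong)
  show "{z \<in> S. poly (q * p) z = 0} = {z \<in> S. poly p z = 0}"
    using assms(3) by auto
  show "order z (q * p) = order z p" if "z \<in> {z \<in> S. poly p z = 0}" for z
    using assms that by (simp add: order_mult order_0I)
qed

lemma num_zeros_in_linear: "c \<in> S \<Longrightarrow> num_zeros_in [:- c, 1:] S = 1"
proof -
  assume "c \<in> S"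
  then have "{z \<in> S. poly [:- c, 1:] z = 0} = {c}"
    by auto
  then show ?thesis
    using order_power_n_n[of c 1] by (simp add: num_zeros_in_def)
qed

text \<open>The fundamental theorem of algebra, split over two disjoint sets.\<close>

lemma num_zeros_in_disjoint_cover:
  fixes p :: "complex poly"
  assumes "p \<noteq> 0" "{z. poly p z = 0} \<subseteq> S \<union> T" "S \<inter> T = {}"
  shows "num_zeros_in p S + num_zeros_in p T = degree p"
proof -
  have "num_zeros_in p S + num_zeros_in p T
      = (\<Sum>z \<in> {z \<in> S. poly p z = 0} \<union> {z \<in> T. poly p z = 0}. order z p)"
    unfolding num_zeros_in_def
    by (rule sum.union_disjoint[symmetric])
      (use assms in \<open>auto intro: finite_subset[OF _ poly_roots_finite[OF assms(1)]]\<close>)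
  also have "{z \<in> S. poly p z = 0} \<union> {z \<in> T. poly p z = 0} = {z. poly p z = 0}"
    using assms(2) by auto
  also have "(\<Sum>z \<in> {z. poly p z = 0}. order z p) = size (proots p)"
    using assms(1) by (simp add: size_multiset_overloaded_eq)
  finally show ?thesis
    by (simp add: size_proots_complex)
qed

section \<open>The cubic multiplier\<close>

text \<open>
  The powers \<open>n + 1\<close>, \<open>n + 2\<close> and \<open>n + 3\<close> come only from \<open>z\<^sup>3\<close> times the three leading terms and
  form the quadratic factor. Below them, the coefficient of \<open>z\<^sup>k\<close> combines \<open>- m a\<^sub>k\<close> with the
  shifted \<open>a\<^bsub>k-3\<^esub>\<close>.
\<close>

lemma cubic_mult_sum:
  fixes a :: "nat \<Rightarrow> 'a::comm_ring_1"
  assumes "n \<ge> 2"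
  shows "(z ^ 3 - m) * (\<Sum>j\<le>n. a j * z ^ j)
    = z ^ (n + 1) * (a n * z\<^sup>2 + a (n - 1) * z + a (n - 2))
      - (\<Sum>k\<le>n. (m * a k - (if k < 3 then 0 else a (k - 3))) * z ^ k)"
  using assms
proof (induction n rule: nat_induct_at_least)
  case base
  show ?case
    by (simp add: numeral_eq_Suc algebra_simps)
next
  case (Suc n)
  then obtain N where N: "n = N + 2"
    by (metis add.commute le_Suc_ex)
  have "(z ^ 3 - m) * (\<Sum>j\<le>Suc n. a j * z ^ j)
      = (z ^ 3 - m) * (\<Sum>j\<le>n. a j * z ^ j) + (z ^ 3 - m) * (a (Suc n) * z ^ Suc n)"
    by (simp add: algebra_simps)
  then show ?case
    unfolding Suc.IH by (simp add: N algebra_simps power2_eq_square power3_eq_cube)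
qed

text \<open>
  The hypothesis \<open>gt\<close> excludes \<open>|z| \<le> \<mu>\<close>, since the quadratic has nonnegative coefficients. For
  \<open>r = |z| > \<mu>\<close>, each term satisfies \<open>b\<^sub>k r\<^sup>k \<le> (r / \<mu>)\<^sup>n b\<^sub>k \<mu>\<^sup>k\<close>, which reduces the sum to its
  value at \<open>\<mu>\<close>; there \<open>cubic_mult_sum\<close> with \<open>z = \<mu>\<close> and \<open>m = \<mu>\<^sup>3\<close> evaluates it exactly, because
  its left side vanishes. The degree gap between \<open>n\<close> and \<open>n + 1\<close> absorbs the remaining \<open>\<mu>\<close>.
\<close>

lemma norm_lower_terms_less:
  fixes a :: "nat \<Rightarrow> real" and z :: complex
  assumes n: "n \<ge> 3" and a: "\<And>j. j \<le> n \<Longrightarrow> a j \<ge> 0" and "\<mu> > 0"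
    and ratio: "\<And>j. j \<le> n - 3 \<Longrightarrow> a j \<le> \<mu> ^ 3 * a (j + 3)"
    and gt: "a n * \<mu>\<^sup>2 + a (n - 1) * \<mu> + a (n - 2)
      < cmod (a n * z\<^sup>2 + a (n - 1) * z + a (n - 2))"
  shows "cmod (\<Sum>k\<le>n. of_real (\<mu> ^ 3 * a k - (if k < 3 then 0 else a (k - 3))) * z ^ k)
    < cmod (z ^ (n + 1) * (a n * z\<^sup>2 + a (n - 1) * z + a (n - 2)))"
proof -
  define b where "b k = \<mu> ^ 3 * a k - (if k < 3 then 0 else a (k - 3))" for k
  define r where "r = cmod z"
  have b: "b k \<ge> 0" if "k \<le> n" for k
    using that a[of k] ratio[of "k - 3"] \<open>\<mu> > 0\<close> by (auto simp: b_def)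
  have "r > \<mu>"
  proof (rule ccontr)
    assume "\<not> r > \<mu>"
    then have r: "0 \<le> r" "r \<le> \<mu>"
      by (simp_all add: r_def)
    have "cmod (a n * z\<^sup>2 + a (n - 1) * z + a (n - 2)) \<le> a n * r\<^sup>2 + a (n - 1) * r + a (n - 2)"
      using a[of n] a[of "n - 1"] a[of "n - 2"]
      by (intro norm_triangle_le add_mono) (auto simp: norm_mult norm_power r_def)
    also have "\<dots> \<le> a n * \<mu>\<^sup>2 + a (n - 1) * \<mu> + a (n - 2)"
      using a[of n] a[of "n - 1"] r by (intro add_mono mult_left_mono power_mono) auto
    finally show False
      using gt by simp
  qed
  then have "r > 0" "r / \<mu> \<ge> 1"
    using \<open>\<mu> > 0\<close> by simp_all
  have "cmod (\<Sum>k\<le>n. of_real (b k) * z ^ k) \<le> (\<Sum>k\<le>n. b k * r ^ k)"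
    by (rule sum_norm_le) (simp add: norm_mult norm_power r_def b)
  also have "\<dots> \<le> (\<Sum>k\<le>n. (r / \<mu>) ^ n * (b k * \<mu> ^ k))"
  proof (rule sum_mono)
    fix k assume k: "k \<in> {..n}"
    have "b k * r ^ k = (r / \<mu>) ^ k * (b k * \<mu> ^ k)"
      using \<open>\<mu> > 0\<close> by (simp add: power_divide)
    also have "\<dots> \<le> (r / \<mu>) ^ n * (b k * \<mu> ^ k)"
      using k b[of k] \<open>\<mu> > 0\<close> \<open>r / \<mu> \<ge> 1\<close> by (intro mult_right_mono power_increasing) auto
    finally show "b k * r ^ k \<le> (r / \<mu>) ^ n * (b k * \<mu> ^ k)" .
  qed
  also have "\<dots> = (r / \<mu>) ^ n * (\<Sum>k\<le>n. b k * \<mu> ^ k)"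
    by (simp add: sum_distrib_left)
  also have "(\<Sum>k\<le>n. b k * \<mu> ^ k) = \<mu> ^ (n + 1) * (a n * \<mu>\<^sup>2 + a (n - 1) * \<mu> + a (n - 2))"
    using cubic_mult_sum[of n \<mu> "\<mu> ^ 3" a] n by (simp add: b_def)
  also have "(r / \<mu>) ^ n * \<dots> = r ^ n * \<mu> * (a n * \<mu>\<^sup>2 + a (n - 1) * \<mu> + a (n - 2))"
    using \<open>\<mu> > 0\<close> by (simp add: power_divide)
  also have "\<dots> \<le> r ^ n * r * (a n * \<mu>\<^sup>2 + a (n - 1) * \<mu> + a (n - 2))"
    using a[of n] a[of "n - 1"] a[of "n - 2"] \<open>r > \<mu>\<close> \<open>r > 0\<close> \<open>\<mu> > 0\<close>
    by (intro mult_right_mono mult_left_mono add_nonneg_nonneg) auto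
  also have "\<dots> < r ^ n * r * cmod (a n * z\<^sup>2 + a (n - 1) * z + a (n - 2))"
    using gt \<open>r > 0\<close> by (intro mult_strict_left_mono) auto
  finally show ?thesis
    by (simp add: b_def r_def norm_mult norm_power mult_ac)
qed

section \<open>Inclusion and separation of the zeros\<close>

lemma disjoint_cballs_same_radiusD:
  fixes x y :: "'a::real_normed_vector"
  assumes "cball x r \<inter> cball y r = {}"
  shows "dist x y > 2 * r"
proof (rule ccontr)
  assume "\<not> dist x y > 2 * r"
  then have "midpoint x y \<in> cball x r \<inter> cball y r"
    by (simp add: dist_midpoint)
  with assms show False
    by blast
qed

theorem theorem5p3:
  fixes p :: "real poly" and n :: nat and a :: "nat \<Rightarrow> real" and P :: "complex poly"
    and \<mu> R d :: real and s c1 c2 :: complex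
  assumes "n \<ge> 3"
    and "p = (\<Sum>j\<le>n. monom (a j) j)"
    and "\<forall>j\<le>n. a j > 0"
    and "P = map_poly complex_of_real p"
    and "\<mu> = root 3 (Max ((\<lambda>j. a j / a (j + 3)) ` {0..n - 3}))"
    and "R = \<mu>\<^sup>2 + a (n - 1) / a n * \<mu> + a (n - 2) / a n"
    and "d = (a (n - 1))\<^sup>2 / (a n)\<^sup>2 - 4 * (a (n - 2) / a n)"
    and "s\<^sup>2 = complex_of_real d"
    and "d \<ge> 0 \<Longrightarrow> s = complex_of_real (sqrt d)"
    and "c1 = (1 / 2) * (- complex_of_real (a (n - 1) / a n) + s)"
    and "c2 = (1 / 2) * (- complex_of_real (a (n - 1) / a n) - s)"
  shows "{z. poly P z = 0} \<subseteq> cball c1 (sqrt R) \<union> cball c2 (sqrt R) \<and>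
    (cball c1 (sqrt R) \<inter> cball c2 (sqrt R) = {} \<longrightarrow>
      c1 \<in> \<real> \<and> c2 \<in> \<real> \<and> Re c2 < Re c1 \<and> Re c1 < 0 \<and>
      num_zeros_in P (cball c2 (sqrt R)) = 1 \<and>
      num_zeros_in P (cball c1 (sqrt R)) = n - 1)"
proof -
  note n = assms(1) and p = assms(2) and P = assms(4) and \<mu> = assms(5) and R = assms(6)
    and d = assms(7) and s = assms(8) and s_real = assms(9) and c1 = assms(10) and c2 = assms(11)
  have a: "a j > 0" if "j \<le> n" for j
    using assms(3) that by blast
  have an: "a n > 0"
    by (simp add: a)
  define M where "M = Max ((\<lambda>j. a j / a (j + 3)) ` {0..n - 3})"
  have M: "a j / a (j + 3) \<le> M" if "j \<le> n - 3" for j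
    unfolding M_def using that by (intro Max_ge) auto
  have "0 < a 0 / a (0 + 3)"
    using a n by simp
  also have "\<dots> \<le> M"
    by (rule M) simp
  finally have "M > 0" .
  then have "\<mu> > 0" and \<mu>3: "\<mu> ^ 3 = M"
    by (simp_all add: \<mu> M_def real_root_pow_pos)
  have ratio: "a j \<le> \<mu> ^ 3 * a (j + 3)" if "j \<le> n - 3" for j
    using M[OF that] a[of "j + 3"] that n by (simp add: \<mu>3 divide_le_eq)
  define B where "B = a (n - 1) / a n"
  define C where "C = a (n - 2) / a n"
  have "B > 0" "C > 0"
    using a n by (simp_all add: B_def C_def)
  have R': "R = \<mu>\<^sup>2 + B * \<mu> + C" and d': "d = B\<^sup>2 - 4 * C"
    by (simp_all add: R d B_def C_def power_divide)
  have "R > C" "R > \<mu>\<^sup>2"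
    using \<open>\<mu> > 0\<close> \<open>B > 0\<close> \<open>C > 0\<close> by (simp_all add: R' add_pos_pos)
  then have "sqrt R > 0"
    using \<open>C > 0\<close> by simp
  have q: "a n * z\<^sup>2 + a (n - 1) * z + a (n - 2) = a n * ((z - c1) * (z - c2))" for z :: complex
  proof -
    have "(z - c1) * (z - c2) = z\<^sup>2 + B * z + (B\<^sup>2 - s\<^sup>2) / 4"
      unfolding c1 c2 B_def[symmetric] by (simp add: field_simps power2_eq_square)
    also have "(B\<^sup>2 - s\<^sup>2) / 4 = C"
      by (simp add: s d')
    finally show ?thesis
      using an by (simp add: B_def C_def field_simps)
  qed

  have coeff_P: "coeff P k = (if k \<le> n then of_real (a k) else 0)" for k
    by (simp add: P p coeff_map_poly coeff_sum if_distrib cong: if_cong)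
  have deg_P: "degree P = n"
    using an by (intro antisym degree_le le_degree) (auto simp: coeff_P)
  then have "P \<noteq> 0"
    using n by auto
  have poly_P: "poly P z = (\<Sum>j\<le>n. of_real (a j) * z ^ j)" for z :: complex
    by (simp add: poly_altdef deg_P coeff_P)

  \<comment> \<open>\<open>K P = f + g\<close>, where \<open>f\<close> is the part of degree above \<open>n\<close>. It is written as a product with
    the factor \<open>z - c\<^sub>2\<close> split off, as needed for counting its zeros near \<open>c\<^sub>2\<close>.\<close>
  define K where "K = [:- of_real (\<mu> ^ 3), 0, 0, 1 :: complex:]"
  define f where "f = (smult (of_real (a n)) ([:0, 1:] ^ (n + 1)) * [:- c1, 1:]) * [:- c2, 1:]"
  define g where "g = K * P - f"
  have poly_K: "poly K z = z ^ 3 - of_real (\<mu> ^ 3)" for z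
    by (simp add: K_def power3_eq_cube)
  have poly_f: "poly f z = z ^ (n + 1) * (a n * z\<^sup>2 + a (n - 1) * z + a (n - 2))" for z :: complex
    unfolding q by (simp add: f_def poly_power algebra_simps)
  have poly_g: "poly g z
      = - (\<Sum>k\<le>n. of_real (\<mu> ^ 3 * a k - (if k < 3 then 0 else a (k - 3))) * z ^ k)" for z :: complex
  proof -
    have "poly g z = - (\<Sum>k\<le>n. (of_real (\<mu> ^ 3) * of_real (a k)
        - (if k < 3 then 0 else of_real (a (k - 3)))) * z ^ k)"
      unfolding g_def using cubic_mult_sum[of n z "of_real (\<mu> ^ 3)" "\<lambda>j. of_real (a j)"] n
      by (simp add: poly_K poly_P poly_f)
    also have "\<dots> = - (\<Sum>k\<le>n. of_real (\<mu> ^ 3 * a k - (if k < 3 then 0 else a (k - 3))) * z ^ k)"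
      by (intro arg_cong[where f = uminus] sum.cong) auto
    finally show ?thesis .
  qed

  have g_less_f: "cmod (poly g z) < cmod (poly f z)" if "R < cmod (z - c1) * cmod (z - c2)" for z
    unfolding poly_g poly_f norm_minus_cancel
  proof (rule norm_lower_terms_less[where a = a, OF n _ \<open>\<mu> > 0\<close> ratio])
    show "0 \<le> a j" if "j \<le> n" for j
      using a[OF that] by simp
    have "a n * \<mu>\<^sup>2 + a (n - 1) * \<mu> + a (n - 2) = a n * R"
      using an by (simp add: R field_simps)
    also have "\<dots> < a n * (cmod (z - c1) * cmod (z - c2))"
      using that an by simp
    also have "\<dots> = cmod (a n * z\<^sup>2 + a (n - 1) * z + a (n - 2))"
      unfolding q using an by (simp add: norm_mult)
    finally show "a n * \<mu>\<^sup>2 + a (n - 1) * \<mu> + a (n - 2)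
        < cmod (a n * z\<^sup>2 + a (n - 1) * z + a (n - 2))" .
  qed

  have incl: "{z. poly P z = 0} \<subseteq> cball c1 (sqrt R) \<union> cball c2 (sqrt R)"
  proof
    fix z assume "z \<in> {z. poly P z = 0}"
    then have "poly g z = - poly f z"
      by (simp add: g_def)
    then have "cmod (poly g z) = cmod (poly f z)"
      by (simp only: norm_minus_cancel)
    with g_less_f[of z] have le: "cmod (z - c1) * cmod (z - c2) \<le> R"
      by force
    show "z \<in> cball c1 (sqrt R) \<union> cball c2 (sqrt R)"
    proof (rule ccontr)
      assume "z \<notin> cball c1 (sqrt R) \<union> cball c2 (sqrt R)"
      then have "sqrt R * sqrt R < cmod (z - c1) * cmod (z - c2)"
        using \<open>sqrt R > 0\<close>
        by (intro mult_strict_mono) (auto simp: dist_norm norm_minus_commute)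
      with le \<open>sqrt R > 0\<close> show False
        by simp
    qed
  qed

  have "c1 \<in> \<real> \<and> c2 \<in> \<real> \<and> Re c2 < Re c1 \<and> Re c1 < 0 \<and>
      num_zeros_in P (cball c2 (sqrt R)) = 1 \<and> num_zeros_in P (cball c1 (sqrt R)) = n - 1"
    if disj: "cball c1 (sqrt R) \<inter> cball c2 (sqrt R) = {}"
  proof -
    have "c1 - c2 = s"
      unfolding c1 c2 B_def[symmetric] by (simp add: field_simps)
    then have "2 * sqrt R < cmod s"
      using disjoint_cballs_same_radiusD[OF disj] by (simp add: dist_norm)
    then have "(2 * sqrt R)\<^sup>2 < (cmod s)\<^sup>2"
      using \<open>sqrt R > 0\<close> by (intro power_strict_mono) auto
    also have "(cmod s)\<^sup>2 = \<bar>d\<bar>"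
      using s by (simp flip: norm_power)
    finally have "4 * R < \<bar>d\<bar>"
      using \<open>sqrt R > 0\<close> by (simp add: power_mult_distrib)
    have "4 * R < d"
    proof (rule ccontr)
      assume "\<not> 4 * R < d"
      with \<open>4 * R < \<bar>d\<bar>\<close> have "4 * R < - d"
        by linarith
      also have "\<dots> \<le> 4 * C"
        by (simp add: d')
      finally show False
        using \<open>R > C\<close> by simp
    qed
    then have "d > 0"
      using \<open>sqrt R > 0\<close> by simp
    then have s': "s = of_real (sqrt d)"
      using s_real by simp
    then have c1': "c1 = of_real ((- B + sqrt d) / 2)" and c2': "c2 = of_real ((- B - sqrt d) / 2)"
      unfolding c1 c2 B_def[symmetric] by (simp_all add: field_simps)
    have "sqrt d < B"
      using \<open>C > 0\<close> \<open>B > 0\<close> by (intro real_less_lsqrt) (simp_all add: d')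
    have "(2 * \<mu>)\<^sup>2 < B\<^sup>2"
      using \<open>4 * R < d\<close> \<open>R > \<mu>\<^sup>2\<close> \<open>C > 0\<close> by (simp add: d' power_mult_distrib)
    then have "2 * \<mu> < B"
      using \<open>B > 0\<close> by (rule power_less_imp_less_base[OF _ less_imp_le])
    have "2 * sqrt R < sqrt d"
      using \<open>2 * sqrt R < cmod s\<close> \<open>d > 0\<close> by (simp add: s')
    \<comment> \<open>The disk around \<open>c\<^sub>2\<close> lies to the left of \<open>- B / 2 < - \<mu>\<close>.\<close>
    have far: "\<mu> < cmod z" if "z \<in> cball c2 (sqrt R)" for z
    proof -
      have "Re (z - c2) \<le> sqrt R"
        using that complex_Re_le_cmod[of "z - c2"] by (simp add: dist_norm norm_minus_commute)
      then have "Re z < - \<mu>"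
        using \<open>2 * \<mu> < B\<close> \<open>2 * sqrt R < sqrt d\<close> unfolding c2' minus_complex.sel Re_complex_of_real
        by argo
      then show ?thesis
        using abs_Re_le_cmod[of z] by linarith
    qed
    have K_nz: "poly K z \<noteq> 0" if "z \<in> cball c2 (sqrt R)" for z
    proof
      assume "poly K z = 0"
      then have "z ^ 3 = of_real (\<mu> ^ 3)"
        by (simp add: poly_K)
      then have "cmod (z ^ 3) = cmod (of_real (\<mu> ^ 3))"
        by (rule arg_cong)
      then have "cmod z ^ 3 = \<mu> ^ 3"
        using \<open>\<mu> > 0\<close> unfolding norm_of_real norm_power by simp
      then have "cmod z = \<mu>"
        using \<open>\<mu> > 0\<close> by (simp add: power_eq_iff_eq_base)
      with far[OF that] show False
        by simp
    qed
    have c1_notin: "z \<noteq> c1" if "z \<in> cball c2 (sqrt R)" for z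
    proof -
      have "c1 \<in> cball c1 (sqrt R)"
        using \<open>sqrt R > 0\<close> by simp
      with disj that show ?thesis
        by blast
    qed

    have "K \<noteq> 0"
      by (simp add: K_def)
    then have "num_zeros_in P (cball c2 (sqrt R)) = num_zeros_in (K * P) (cball c2 (sqrt R))"
      using K_nz \<open>P \<noteq> 0\<close> by (intro num_zeros_in_mult_nonvanishing[symmetric])
    also have "\<dots> = num_zeros_in (f + g) (cball c2 (sqrt R))"
      by (simp add: g_def)
    also have "\<dots> = num_zeros_in f (cball c2 (sqrt R))"
    proof (rule Rouche_poly_cball[OF \<open>sqrt R > 0\<close>])
      fix z assume z: "z \<in> sphere c2 (sqrt R)"
      then have "z \<notin> cball c1 (sqrt R)"
        using disj sphere_cball[of c2 "sqrt R"] by blast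
      then have "sqrt R * sqrt R < cmod (z - c1) * sqrt R"
        using \<open>sqrt R > 0\<close>
        by (intro mult_strict_right_mono) (simp_all add: dist_norm norm_minus_commute)
      also have "\<dots> = cmod (z - c1) * cmod (z - c2)"
        using z by (simp add: dist_norm norm_minus_commute)
      finally show "cmod (poly g z) < cmod (poly f z)"
        using \<open>sqrt R > 0\<close> by (intro g_less_f) simp
    qed
    also have "\<dots> = num_zeros_in [:- c2, 1:] (cball c2 (sqrt R))"
      unfolding f_def
    proof (rule num_zeros_in_mult_nonvanishing)
      show "poly (smult (of_real (a n)) ([:0, 1:] ^ (n + 1)) * [:- c1, 1:]) z \<noteq> 0"
        if "z \<in> cball c2 (sqrt R)" for z
      proof -
        have "z \<noteq> 0"
          using far[OF that] \<open>\<mu> > 0\<close> by auto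
        then show ?thesis
          using c1_notin[OF that] an by (simp add: poly_power)
      qed
      show "smult (complex_of_real (a n)) ([:0, 1:] ^ (n + 1)) * [:- c1, 1:] \<noteq> 0"
        unfolding mult_eq_0_iff smult_eq_0_iff using an by (simp del: power_Suc)
    qed simp
    also have "\<dots> = 1"
      using \<open>sqrt R > 0\<close> by (intro num_zeros_in_linear) simp
    finally have "num_zeros_in P (cball c2 (sqrt R)) = 1" .
    moreover have "num_zeros_in P (cball c1 (sqrt R)) + num_zeros_in P (cball c2 (sqrt R)) = n"
      using num_zeros_in_disjoint_cover[OF \<open>P \<noteq> 0\<close> incl disj] by (simp add: deg_P)
    ultimately show ?thesis
      using \<open>d > 0\<close> \<open>sqrt d < B\<close> by (auto simp: c1' c2')
  qed
  with incl show ?thesis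
    by blast
qed

end
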